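(* Let $Q$ be a substochastic $d\times d$ matrix with nonnegative entries, $Q_{ii}=0$ for all $i$ and $Q^n\to0$; let $R=(I-Q)^T$, let $r,\rho\in\mathbb R^d$ satisfy the stability condition $R^{-1}\rho<r$ (componentwise), and put $r'=r-R^{-1}\rho>0$. Let $a>0$, $c\in\{0,1\}^d$ and $\mathcal J_c=\{j:c_j=1\}$. Let $\mathcal J\subseteq(\mathcal J_c)^c$, and let $\{r_i^*\}_{i\notin\mathcal J}$ be such that $$r_i^*=\max\Big\{r_i'-\sum_{j\ne i}Q_{ji}r_j'+\sum_{j\ne i,\,j\notin\mathcal J}Q_{ji}r_j^*,\,0\Big\},\qquad i\notin\mathcal J.$$ Define $$\partial_z(\mathcal J)=\sum_{i\in\mathcal J_c}\Big(r_i^*-r_i'+\sum_{j\ne i}Q_{ji}r_j'-\sum_{j\ne i,\,j\notin\mathcal J}Q_{ji}r_j^*\Big).$$ If $\partial_z(\mathcal J)\ne a$, then there exists $\xi\in\mathbb D^d$ of the form $$\xi^{(i)}(t)=-(Rr')_i\,t\ \ (i\notin\mathcal J),\qquad \xi^{(i)}(t)=\theta^{(i)}(t)-(Rr')_i\,t\ \ (i\in\mathcal J),\qquad t\in[0,1],$$ with $\theta^{(i)}\in\mathbb D_1$ for each $i\in\mathcal J$, satisfying $c^T\phi(\xi)(1)\ge a$, if and only if $\partial_z(\mathcal J)>a$. Additionally, if $\mathcal J_1\subseteq\mathcal J_2\subseteq(\mathcal J_c)^c$, then $\partial_z(\mathcal J_1)\le\partial_z(\mathcal J_2)$.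
   Context: $\mathbb D$ is the space of real-valued càdlàg functions on $[0,1]$; $\mathbb D_1$ is the set of non-decreasing step functions in $\mathbb D$ vanishing at time $0$ with exactly one jump; $\mathbb D_\uparrow^d$ is the set of functions in $\mathbb D^d$ that are non-negative and non-decreasing in each coordinate. The Skorokhod (reflection) maps are $\psi:\mathbb D^d\to\mathbb D_\uparrow^d$, $\psi(x)=\inf\{w\in\mathbb D_\uparrow^d:x+Rw\ge0\}$, meaning $\psi^{(i)}(x)(t)=\inf\{w^{(i)}(t):w\in\mathbb D_\uparrow^d,\ x+Rw\ge0\}$ for all $i,t$, and $\phi(x)=x+R\psi(x)$; these are well defined for every $x\in\mathbb D^d$. In the paper $\rho=\mathbb E J(1)$ is the mean external input rate, $r$ the vector of service rates and $Q$ the routing matrix of a $d$-station stochastic fluid network. *)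

theory Defs
  imports "HOL-Analysis.Analysis"
begin

text \<open>
  Paths on the interval from 0 to 1 are represented by functions on all of \<^typ>\<open>real\<close>;
  every notion below only inspects their values at times in \<open>{0..1}\<close>.
\<close>

definition cadlag :: "(real \<Rightarrow> real) set" where
  "cadlag = {f. (\<forall>t\<in>{0..<1}. (f \<longlongrightarrow> f t) (at_right t)) \<and>
                (\<forall>t\<in>{0<..1}. \<exists>l. (f \<longlongrightarrow> l) (at_left t))}"

text \<open>
  Right-continuous step functions: for some finite set \<open>P\<close> of break points, the function does
  not change between two times \<open>s \<le> t\<close> unless a break point lies in \<open>{s<..t}\<close>, i.e. it is constant
  on half-open pieces that are closed on the left.
\<close>

definition step_path :: "(real \<Rightarrow> real) \<Rightarrow> bool" where
  "step_path f \<longleftrightarrow>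
     (\<exists>P. finite P \<and>
        (\<forall>s\<in>{0..1}. \<forall>t\<in>{0..1}. s \<le> t \<longrightarrow> {s<..t} \<inter> P = {} \<longrightarrow> f s = f t))"

definition jump_times :: "(real \<Rightarrow> real) \<Rightarrow> real set" where
  "jump_times f = {t\<in>{0..1}. \<not> continuous (at t within {0..1}) f}"

definition one_jump_paths :: "(real \<Rightarrow> real) set" where
  "one_jump_paths =
     {f \<in> cadlag. mono_on {0..1} f \<and> step_path f \<and> f 0 = 0 \<and> card (jump_times f) = 1}"

definition cadlag_vec :: "(real \<Rightarrow> real^'n) set" where
  "cadlag_vec = {x. \<forall>i. (\<lambda>t. x t $ i) \<in> cadlag}"

definition cadlag_up :: "(real \<Rightarrow> real^'n) set" where
  "cadlag_up = {w \<in> cadlag_vec. \<forall>i. (\<forall>t\<in>{0..1}. 0 \<le> w t $ i) \<and> mono_on {0..1} (\<lambda>t. w t $ i)}"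

definition feasible_regulators :: "real^'n^'n \<Rightarrow> (real \<Rightarrow> real^'n) \<Rightarrow> (real \<Rightarrow> real^'n) set" where
  "feasible_regulators R x =
     {w \<in> cadlag_up. \<forall>t\<in>{0..1}. \<forall>i. 0 \<le> (x t + R *v w t) $ i}"

definition regulator_map :: "real^'n^'n \<Rightarrow> (real \<Rightarrow> real^'n) \<Rightarrow> real \<Rightarrow> real^'n" where
  "regulator_map R x t = (\<chi> i. INF w\<in>feasible_regulators R x. w t $ i)"

definition reflection_map :: "real^'n^'n \<Rightarrow> (real \<Rightarrow> real^'n) \<Rightarrow> real \<Rightarrow> real^'n" where
  "reflection_map R x t = x t + R *v regulator_map R x t"

text \<open>
  The matrix product \<open>**\<close> is iterated explicitly because \<open>^\<close> on \<^typ>\<open>real^'n^'n\<close> is the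
  componentwise power.
\<close>

definition mat_power :: "real^'n^'n \<Rightarrow> nat \<Rightarrow> real^'n^'n" where
  "mat_power A n = (((**) A) ^^ n) (mat 1)"

definition routing_matrix :: "real^'n^'n \<Rightarrow> bool" where
  "routing_matrix Q \<longleftrightarrow>
     (\<forall>i j. 0 \<le> Q$i$j) \<and> (\<forall>i. (\<Sum>j\<in>UNIV. Q$i$j) \<le> 1) \<and> (\<forall>i. Q$i$i = 0) \<and>
     mat_power Q \<longlonglongrightarrow> 0"

text \<open>
  In the next two definitions only the coordinates of \<open>s\<close> outside \<open>J\<close> matter (\<open>Jc\<close> is
  disjoint from \<open>J\<close> in all uses): \<open>s\<close> encodes a family of reals indexed by the complement
  of \<open>J\<close>.
\<close>

definition is_rstar :: "real^'n^'n \<Rightarrow> real^'n \<Rightarrow> 'n set \<Rightarrow> real^'n \<Rightarrow> bool" where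
  "is_rstar Q r' J s \<longleftrightarrow>
     (\<forall>i. i \<notin> J \<longrightarrow>
        s$i = max (r'$i - (\<Sum>j | j \<noteq> i. Q$j$i * r'$j) + (\<Sum>j | j \<noteq> i \<and> j \<notin> J. Q$j$i * s$j)) 0)"

definition boundary_rate ::
    "real^'n^'n \<Rightarrow> real^'n \<Rightarrow> 'n set \<Rightarrow> 'n set \<Rightarrow> real^'n \<Rightarrow> real" where
  "boundary_rate Q r' Jc J s =
     (\<Sum>i\<in>Jc. s$i - r'$i + (\<Sum>j | j \<noteq> i. Q$j$i * r'$j) - (\<Sum>j | j \<noteq> i \<and> j \<notin> J. Q$j$i * s$j))"

end

theory Submission
  imports Defs
begin

text \<open>
  The regulator \<open>\<psi>(\<xi>)\<close> is itself feasible, hence the least feasible regulator. Whatever the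
  jumps in \<open>J\<close> are, the coordinates \<open>j \<notin> J\<close> of \<open>\<psi>(\<xi>)\<close> grow at least at the rates \<open>r\<^sub>j\<^sup>*\<close>, so
  a station \<open>i \<notin> J\<close> needs no more regulation than is forced by its inflow plus its overflow rate
  in the summand of the boundary rate; this bounds \<open>c\<^sup>T \<phi>(\<xi>)(1)\<close> by the boundary rate. The
  bound is approached by letting all stations in \<open>J\<close> make a large jump shortly after time \<open>0\<close>.
  The slope bound and the antitonicity of \<open>r\<^sup>*\<close> in \<open>J\<close> come from a comparison principle: a
  non-negative vector dominated by its own image under the transpose of \<open>Q\<close> vanishes since \<open>Q\<^sup>n \<longlonglongrightarrow> 0\<close>.
\<close>

section \<open>Comparison principle for the transposed routing matrix\<close>

lemma transpose_mat_1_diff_mult: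
  fixes Q :: "real^'n^'n" and w :: "real^'n"
  shows "(transpose (mat 1 - Q) *v w) $ i = w $ i - (\<Sum>j\<in>UNIV. Q $ j $ i * w $ j)"
proof -
  have "(transpose (mat 1 - Q) *v w) $ i
      = (\<Sum>j\<in>UNIV. (if j = i then w $ j else 0) - Q $ j $ i * w $ j)"
    unfolding matrix_vector_mult_def transpose_def mat_def
    by (auto intro!: sum.cong simp: algebra_simps)
  then show ?thesis
    by (simp add: sum_subtractf)
qed

lemma sum_routing_mono:
  assumes "routing_matrix Q" and "\<And>j. v j \<le> w j"
  shows "(\<Sum>j\<in>UNIV. Q $ j $ i * v j) \<le> (\<Sum>j\<in>UNIV. Q $ j $ i * w j)"
  using assms by (intro sum_mono mult_left_mono) (auto simp: routing_matrix_def)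

lemma mat_power_nonneg:
  fixes Q :: "real^'n^'n"
  assumes "\<And>i j. 0 \<le> Q $ i $ j"
  shows "0 \<le> mat_power Q n $ i $ j"
proof (induction n arbitrary: i j)
  case 0
  show ?case
    by (simp add: mat_power_def mat_def)
next
  case (Suc n)
  have "mat_power Q (Suc n) = Q ** mat_power Q n"
    by (simp add: mat_power_def)
  then show ?case
    using Suc assms by (auto simp: matrix_matrix_mult_def intro!: sum_nonneg)
qed

text \<open>The positive part \<open>e\<close> of \<open>d\<close> is dominated by its image under
  the transpose of \<open>Q\<close>. Iterating bounds \<open>e\<close> by its image under the
  transpose of \<open>mat_power Q n\<close>, which tends to \<open>0\<close>.\<close>

lemma routing_subinvariant_nonpos:
  fixes Q :: "real^'n^'n" and d :: "'n \<Rightarrow> real"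
  assumes Q: "routing_matrix Q"
    and d: "\<And>i. d i \<le> (\<Sum>j\<in>UNIV. Q $ j $ i * max (d j) 0)"
  shows "d i \<le> 0"
proof -
  define e where "e = (\<lambda>i. max (d i) 0)"
  have Q0: "\<And>i j. 0 \<le> Q $ i $ j"
    using Q by (simp add: routing_matrix_def)
  \<comment> \<open>If \<open>d i\<close> is negative, then \<open>e i = 0\<close> and the
    non-negative right-hand side suffices.\<close>
  have e: "e i \<le> (\<Sum>j\<in>UNIV. Q $ j $ i * e j)" for i
    using d[of i] Q0 by (auto simp: e_def intro!: sum_nonneg)
  have le: "e i \<le> (\<Sum>j\<in>UNIV. e j * mat_power Q n $ j $ i)" for n i
  proof (induction n arbitrary: i)
    case 0
    show ?case
      by (simp add: mat_power_def mat_def if_distrib cong: if_cong)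
  next
    case (Suc n)
    have "(\<Sum>j\<in>UNIV. e j * mat_power Q (Suc n) $ j $ i)
        = (\<Sum>j\<in>UNIV. \<Sum>k\<in>UNIV. e j * (Q $ j $ k * mat_power Q n $ k $ i))"
      by (simp add: mat_power_def matrix_matrix_mult_def sum_distrib_left)
    also have "\<dots> = (\<Sum>k\<in>UNIV. \<Sum>j\<in>UNIV. e j * (Q $ j $ k * mat_power Q n $ k $ i))"
      by (rule sum.swap)
    also have "\<dots> = (\<Sum>k\<in>UNIV. (\<Sum>j\<in>UNIV. Q $ j $ k * e j) * mat_power Q n $ k $ i)"
      by (simp add: sum_distrib_right) (simp add: mult_ac)
    also have "\<dots> \<ge> (\<Sum>k\<in>UNIV. e k * mat_power Q n $ k $ i)"
      using e mat_power_nonneg[OF Q0] by (intro sum_mono mult_right_mono) auto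
    finally show ?case
      using Suc[of i] by linarith
  qed
  have "mat_power Q \<longlonglongrightarrow> 0"
    using Q by (simp add: routing_matrix_def)
  then have "(\<lambda>n. mat_power Q n $ j $ i) \<longlonglongrightarrow> 0" for j
    using tendsto_vec_nth[OF tendsto_vec_nth, of "mat_power Q" 0 sequentially j i] by simp
  then have "(\<lambda>n. \<Sum>j\<in>UNIV. e j * mat_power Q n $ j $ i) \<longlonglongrightarrow> (\<Sum>j\<in>UNIV. e j * 0)"
    by (intro tendsto_intros)
  then have "e i \<le> 0"
    using le by (intro LIMSEQ_le_const[where X = "\<lambda>n. \<Sum>j\<in>UNIV. e j * mat_power Q n $ j $ i"]) auto
  then show ?thesis
    by (simp add: e_def)
qed

text \<open>A subsolution \<open>S\<close> of the fixed-point equation lies below a supersolution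
  \<open>T\<close>. The first disjunct admits coordinates, such as those in \<open>J\<close>, where
  the inequality is known directly.\<close>

lemma routing_comparison:
  fixes Q :: "real^'n^'n" and S T z :: "'n \<Rightarrow> real"
  assumes Q: "routing_matrix Q"
    and ST: "\<And>i. S i \<le> T i \<or> (S i \<le> max (z i + (\<Sum>j\<in>UNIV. Q $ j $ i * S j)) 0 \<and>
                              max (z i + (\<Sum>j\<in>UNIV. Q $ j $ i * T j)) 0 \<le> T i)"
  shows "S i \<le> T i"
proof -
  have "S i - T i \<le> (\<Sum>j\<in>UNIV. Q $ j $ i * max (S j - T j) 0)" for i
  proof -
    have nn: "0 \<le> (\<Sum>j\<in>UNIV. Q $ j $ i * max (S j - T j) 0)"
      using Q by (auto simp: routing_matrix_def intro!: sum_nonneg)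
    have "(\<Sum>j\<in>UNIV. Q $ j $ i * S j) - (\<Sum>j\<in>UNIV. Q $ j $ i * T j)
        = (\<Sum>j\<in>UNIV. Q $ j $ i * (S j - T j))"
      by (simp add: sum_subtractf algebra_simps)
    also have "\<dots> \<le> (\<Sum>j\<in>UNIV. Q $ j $ i * max (S j - T j) 0)"
      by (rule sum_routing_mono[OF Q]) simp
    \<comment> \<open>In the second case of \<open>ST\<close>, the map \<open>max _ 0\<close> is
      non-decreasing and 1-Lipschitz, so \<open>S i - T i\<close> is at most the positive part of
      the difference of the two inflows; in the first case it is at most \<open>0\<close>.\<close>
    finally show ?thesis
      using ST[of i] nn by linarith
  qed
  from routing_subinvariant_nonpos[OF Q this, of i] show ?thesis
    by simp
qed

section \<open>Cadlag paths: closure properties and a criterion for monotone paths\<close>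

lemma cadlag_add: "f \<in> cadlag \<Longrightarrow> g \<in> cadlag \<Longrightarrow> (\<lambda>t. f t + g t) \<in> cadlag"
  unfolding cadlag_def by (auto intro!: tendsto_add) (metis greaterThanAtMost_iff tendsto_add)

lemma cadlag_min: "f \<in> cadlag \<Longrightarrow> g \<in> cadlag \<Longrightarrow> (\<lambda>t. min (f t) (g t)) \<in> cadlag"
  unfolding cadlag_def by (auto intro!: tendsto_min) (metis greaterThanAtMost_iff tendsto_min)

lemma cadlag_cmult: "f \<in> cadlag \<Longrightarrow> (\<lambda>t. k * f t) \<in> cadlag"
  unfolding cadlag_def by (auto intro!: tendsto_mult_left) (metis greaterThanAtMost_iff tendsto_mult_left)

lemma cadlag_continuous: "continuous_on UNIV f \<Longrightarrow> f \<in> cadlag"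
  unfolding cadlag_def
  by (auto simp: continuous_on_eq_continuous_at continuous_at intro: filterlim_at_split[THEN iffD1, THEN conjunct2]
      filterlim_at_split[THEN iffD1, THEN conjunct1])

lemma cadlag_sum:
  "finite A \<Longrightarrow> (\<And>i. i \<in> A \<Longrightarrow> f i \<in> cadlag) \<Longrightarrow> (\<lambda>t. \<Sum>i\<in>A. f i t) \<in> cadlag"
  by (induction A rule: finite_induct) (auto intro: cadlag_add cadlag_continuous)

text \<open>Left limits of a monotone path are suprema, and its values to the right of
  \<open>t\<close> are at least \<open>f t\<close>. What remains is a one-sided bound from above, a
  condition that survives pointwise infima.\<close>

lemma cadlag_mono_on:
  assumes mono: "mono_on {0..1} f"
    and right: "\<And>t e. 0 \<le> t \<Longrightarrow> t < 1 \<Longrightarrow> 0 < e \<Longrightarrow> \<exists>u\<in>{t<..1}. f u < f t + e"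
  shows "f \<in> cadlag"
proof -
  have "(f \<longlongrightarrow> f t) (at_right t)" if "0 \<le> t" "t < 1" for t
  proof (rule tendstoI)
    fix e :: real assume "0 < e"
    with right[OF that] obtain u where u: "t < u" "u \<le> 1" "f u < f t + e"
      by force
    have "\<forall>\<^sub>F s in at_right t. s \<in> {t<..<u}"
      using u(1) by (rule eventually_at_right_real)
    then show "\<forall>\<^sub>F s in at_right t. dist (f s) (f t) < e"
    proof eventually_elim
      case (elim s)
      then have "f t \<le> f s" "f s \<le> f u"
        using that u by (auto intro!: mono_onD[OF mono])
      then show ?case
        using u by (simp add: dist_real_def)
    qed
  qed
  moreover have "(f \<longlongrightarrow> (SUP s\<in>{0..<t}. f s)) (at_left t)" if "0 < t" "t \<le> 1" for t
  proof (rule tendstoI)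
    fix e :: real assume "0 < e"
    have bdd: "bdd_above (f ` {0..<t})"
      using that by (intro bdd_aboveI2[where M = "f t"] mono_onD[OF mono]) auto
    have "\<exists>s\<in>{0..<t}. (SUP s\<in>{0..<t}. f s) - e < f s"
      using that \<open>0 < e\<close> by (subst less_cSUP_iff[OF _ bdd, symmetric]) auto
    then obtain s where s: "0 \<le> s" "s < t" "(SUP s\<in>{0..<t}. f s) - e < f s"
      by auto
    have "\<forall>\<^sub>F u in at_left t. u \<in> {s<..<t}"
      using s(2) by (rule eventually_at_left_real)
    then show "\<forall>\<^sub>F u in at_left t. dist (f u) (SUP s\<in>{0..<t}. f s) < e"
    proof eventually_elim
      case (elim u)
      then have "f s \<le> f u"
        using that s by (auto intro!: mono_onD[OF mono])
      moreover have "f u \<le> (SUP s\<in>{0..<t}. f s)"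
        using elim s by (intro cSUP_upper bdd) auto
      ultimately show ?case
        using s \<open>0 < e\<close> by (simp add: dist_real_def)
    qed
  qed
  ultimately show ?thesis
    unfolding cadlag_def by fastforce
qed

lemma cadlag_right_less:
  assumes "f \<in> cadlag" "0 \<le> t" "t < 1" "0 < e"
  shows "\<exists>u\<in>{t<..1}. f u < f t + e"
proof -
  have "(f \<longlongrightarrow> f t) (at_right t)"
    using assms by (auto simp: cadlag_def)
  then have "\<forall>\<^sub>F s in at_right t. f s < f t + e"
    using assms by (intro order_tendstoD) auto
  moreover have "\<forall>\<^sub>F s in at_right t. s \<in> {t<..<1}"
    using assms(3) by (rule eventually_at_right_real)
  ultimately have "\<forall>\<^sub>F s in at_right t. f s < f t + e \<and> s \<in> {t<..<1}"
    by eventually_elim auto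
  then obtain s where "f s < f t + e" "s \<in> {t<..<1}"
    using eventually_happens'[OF trivial_limit_at_right_real] by blast
  then show ?thesis
    by (intro bexI[of _ s]) auto
qed

section \<open>The least feasible regulator\<close>

text \<open>Moving the inflow to the other side turns the constraint on coordinate \<open>i\<close>
  into a lower bound that, for non-negative \<open>Q\<close>, is non-decreasing in \<open>w\<close>.
  Taking infima and lowering single coordinates both rest on this form.\<close>

lemma feasible_regulators_iff:
  fixes Q :: "real^'n^'n"
  shows "w \<in> feasible_regulators (transpose (mat 1 - Q)) x \<longleftrightarrow>
    (\<forall>i. (\<lambda>t. w t $ i) \<in> cadlag) \<and> (\<forall>i. \<forall>t\<in>{0..1}. 0 \<le> w t $ i) \<and>
    (\<forall>i. mono_on {0..1} (\<lambda>t. w t $ i)) \<and>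
    (\<forall>i. \<forall>t\<in>{0..1}. (\<Sum>j\<in>UNIV. Q $ j $ i * w t $ j) - x t $ i \<le> w t $ i)"
  unfolding feasible_regulators_def cadlag_up_def cadlag_vec_def mem_Collect_eq
    vector_add_component transpose_mat_1_diff_mult
  by (auto simp: algebra_simps)

lemma regulator_map_le:
  assumes "w \<in> feasible_regulators R x" "t \<in> {0..1}"
  shows "regulator_map R x t $ i \<le> w t $ i"
  unfolding regulator_map_def vec_lambda_beta
  using assms
  by (intro cINF_lower bdd_belowI2[where m = 0]) (auto simp: feasible_regulators_def cadlag_up_def)

text \<open>Each constraint bounds \<open>w t $ i\<close> below by a quantity that only decreases
  when \<open>w\<close> is replaced by the infimum, so it passes to the infimum. Non-emptiness makes
  the real infimum meaningful.\<close>

lemma regulator_map_feasible: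
  fixes Q :: "real^'n^'n"
  assumes Q: "routing_matrix Q"
    and R: "R = transpose (mat 1 - Q)"
    and ne: "feasible_regulators R x \<noteq> {}"
  shows "regulator_map R x \<in> feasible_regulators R x"
proof -
  let ?F = "feasible_regulators R x" and ?p = "regulator_map R x"
  note iff = feasible_regulators_iff[of _ Q x, folded R]
  have greatest: "m \<le> ?p t $ i" if "\<And>w. w \<in> ?F \<Longrightarrow> m \<le> w t $ i" for m t i
    unfolding regulator_map_def vec_lambda_beta using ne that by (intro cINF_greatest) auto
  have mono: "mono_on {0..1} (\<lambda>t. ?p t $ i)" for i
  proof (rule mono_onI)
    fix s t :: real assume st: "s \<in> {0..1}" "t \<in> {0..1}" "s \<le> t"
    show "?p s $ i \<le> ?p t $ i"
    proof (rule greatest)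
      fix w assume w: "w \<in> ?F"
      then have "mono_on {0..1} (\<lambda>t. w t $ i)"
        by (simp add: iff)
      then show "?p s $ i \<le> w t $ i"
        using regulator_map_le[OF w st(1), of i] mono_onD[of _ _ s t] st by fastforce
    qed
  qed
  have "(\<lambda>t. ?p t $ i) \<in> cadlag" for i
  proof (rule cadlag_mono_on[OF mono])
    fix t e :: real assume t: "0 \<le> t" "t < 1" "0 < e"
    \<comment> \<open>Half of \<open>e\<close> is spent on a regulator nearly optimal at
      \<open>t\<close>, the other half on its right-continuity; \<open>?p\<close> lies below that
      regulator at the later time as well.\<close>
    have "\<exists>w\<in>?F. w t $ i < ?p t $ i + e / 2"
    proof (rule ccontr)
      assume "\<not> ?thesis"
      then have "?p t $ i + e / 2 \<le> ?p t $ i"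
        by (intro greatest) (auto simp: not_less)
      with t show False
        by simp
    qed
    then obtain w where w: "w \<in> ?F" "w t $ i < ?p t $ i + e / 2"
      by blast
    have "(\<lambda>t. w t $ i) \<in> cadlag"
      using w by (simp add: iff)
    then obtain u where u: "u \<in> {t<..1}" "w u $ i < w t $ i + e / 2"
      using cadlag_right_less[of "\<lambda>t. w t $ i" t "e / 2"] t by auto
    then show "\<exists>u\<in>{t<..1}. ?p u $ i < ?p t $ i + e"
      using w regulator_map_le[OF w(1), of u i] t by (intro bexI[of _ u]) auto
  qed
  moreover have "0 \<le> ?p t $ i" if "t \<in> {0..1}" for t i
    using that by (intro greatest) (auto simp: iff)
  moreover have "(\<Sum>j\<in>UNIV. Q $ j $ i * ?p t $ j) - x t $ i \<le> ?p t $ i" if t: "t \<in> {0..1}" for t i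
  proof (rule greatest)
    fix w assume w: "w \<in> ?F"
    have "(\<Sum>j\<in>UNIV. Q $ j $ i * ?p t $ j) \<le> (\<Sum>j\<in>UNIV. Q $ j $ i * w t $ j)"
      by (rule sum_routing_mono[OF Q regulator_map_le[OF w t]])
    moreover have "(\<Sum>j\<in>UNIV. Q $ j $ i * w t $ j) - x t $ i \<le> w t $ i"
      using w t by (simp add: iff)
    ultimately show "(\<Sum>j\<in>UNIV. Q $ j $ i * ?p t $ j) - x t $ i \<le> w t $ i"
      by linarith
  qed
  ultimately show ?thesis
    using mono by (auto simp: iff)
qed

text \<open>
  Lowering one coordinate of a regulator only relaxes the constraints on the other coordinates,
  so the coordinates of the least regulator are determined one at a time.
\<close>

lemma regulator_map_coordinate_le:
  fixes Q :: "real^'n^'n"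
  assumes Q: "routing_matrix Q"
    and R: "R = transpose (mat 1 - Q)"
    and ne: "feasible_regulators R x \<noteq> {}"
    and h: "h \<in> cadlag" "mono_on {0..1} h" "\<And>t. t \<in> {0..1} \<Longrightarrow> 0 \<le> h t"
    and ge: "\<And>t. t \<in> {0..1} \<Longrightarrow>
      (\<Sum>j\<in>UNIV. Q $ j $ i * regulator_map R x t $ j) - x t $ i \<le> h t"
    and t: "t \<in> {0..1}"
  shows "regulator_map R x t $ i \<le> h t"
proof -
  let ?p = "regulator_map R x"
  note iff = feasible_regulators_iff[of _ Q x, folded R]
  have p: "?p \<in> feasible_regulators R x"
    by (rule regulator_map_feasible[OF Q R ne])
  \<comment> \<open>Both \<open>h\<close> and \<open>?p\<close> meet the lower bound at
    \<open>i\<close>, hence so does their minimum; taking the minimum also keeps \<open>w\<close>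
    below \<open>?p\<close>, so that no inflow grows.\<close>
  define w where "w = (\<lambda>t. \<chi> j. if j = i then min (h t) (?p t $ i) else ?p t $ j)"
  have wp: "w t $ j \<le> ?p t $ j" for t j
    by (simp add: w_def)
  have "(\<Sum>k\<in>UNIV. Q $ k $ j * w t $ k) - x t $ j \<le> w t $ j" if t: "t \<in> {0..1}" for t j
  proof -
    have "(\<Sum>k\<in>UNIV. Q $ k $ j * w t $ k) \<le> (\<Sum>k\<in>UNIV. Q $ k $ j * ?p t $ k)"
      by (rule sum_routing_mono[OF Q wp])
    moreover have "(\<Sum>k\<in>UNIV. Q $ k $ j * ?p t $ k) - x t $ j \<le> ?p t $ j"
      using p t by (simp add: iff)
    ultimately show ?thesis
      using ge[OF t] by (auto simp: w_def)
  qed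
  moreover have "(\<lambda>t. w t $ j) \<in> cadlag" for j
    using p h by (cases "j = i") (auto simp: w_def iff intro: cadlag_min)
  moreover have "mono_on {0..1} (\<lambda>t. w t $ j)" for j
  proof (cases "j = i")
    case True
    have "mono_on {0..1} (\<lambda>t. ?p t $ i)"
      using p by (simp add: iff)
    then show ?thesis
      using h(2) True by (simp add: w_def mono_on_def min.coboundedI1 min.coboundedI2)
  qed (use p in \<open>simp add: w_def iff\<close>)
  moreover have "0 \<le> w t $ j" if "t \<in> {0..1}" for t j
    using p h(3) that by (auto simp: w_def iff)
  ultimately have "w \<in> feasible_regulators R x"
    by (auto simp: iff)
  from regulator_map_le[OF this t, of i] show ?thesis
    by (simp add: w_def)
qed

section \<open>Slopes of the regulator and the upper bound on the reflected path\<close>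

lemma reflection_map_nth:
  assumes "R = transpose (mat 1 - Q)"
  shows "reflection_map R x t $ i
    = x t $ i + regulator_map R x t $ i - (\<Sum>j\<in>UNIV. Q $ j $ i * regulator_map R x t $ j)"
  unfolding reflection_map_def assms vector_add_component transpose_mat_1_diff_mult by simp

text \<open>The candidate bounds passed to \<open>regulator_map_coordinate_le\<close> below are all
  an inflow plus a linear function.\<close>

lemma cadlag_regulator_inflow:
  fixes Q :: "real^'n^'n"
  assumes R: "R = transpose (mat 1 - Q)"
    and w: "w \<in> feasible_regulators R x"
  shows "(\<lambda>t. (\<Sum>j\<in>UNIV. Q $ j $ i * w t $ j) + k * t) \<in> cadlag"
proof (rule cadlag_add)
  show "(\<lambda>t. \<Sum>j\<in>UNIV. Q $ j $ i * w t $ j) \<in> cadlag"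
    using w unfolding R feasible_regulators_iff by (intro cadlag_sum cadlag_cmult) auto
qed (intro cadlag_continuous continuous_intros)

text \<open>
  The best lower bounds \<open>D\<close> on the slopes of the regulator form a supersolution of the
  fixed-point equation of \<open>S\<close>: where the right-hand side of the equation is positive at \<open>D\<close>,
  the required regulation is itself increasing, so the regulator equals it.
\<close>

lemma regulator_map_slope:
  fixes Q :: "real^'n^'n" and S z :: "'n \<Rightarrow> real"
  assumes Q: "routing_matrix Q"
    and R: "R = transpose (mat 1 - Q)"
    and ne: "feasible_regulators R x \<noteq> {}"
    and x: "\<And>i t. i \<notin> J \<Longrightarrow> t \<in> {0..1} \<Longrightarrow> x t $ i = - z i * t"
    and SJ: "\<And>i. i \<in> J \<Longrightarrow> S i = 0"
    and S: "\<And>i. i \<notin> J \<Longrightarrow> S i = max (z i + (\<Sum>j\<in>UNIV. Q $ j $ i * S j)) 0"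
    and st: "0 \<le> s" "s \<le> t" "t \<le> 1"
  shows "S i * (t - s) \<le> regulator_map R x t $ i - regulator_map R x s $ i"
proof -
  let ?p = "regulator_map R x"
  have p: "?p \<in> feasible_regulators R x"
    by (rule regulator_map_feasible[OF Q R ne])
  note pf = p[unfolded R feasible_regulators_iff, folded R]
  have pmono: "?p s $ i \<le> ?p t $ i" if "0 \<le> s" "s \<le> t" "t \<le> 1" for s t i
  proof -
    have "mono_on {0..1} (\<lambda>t. ?p t $ i)"
      using pf by auto
    from mono_onD[OF this, of s t] show ?thesis
      using that by auto
  qed
  define I where "I = {(s, t). 0 \<le> s \<and> s < t \<and> t \<le> (1::real)}"
  define D where "D = (\<lambda>i. INF (s, t)\<in>I. (?p t $ i - ?p s $ i) / (t - s))"
  have I_ne: "(0, 1) \<in> I"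
    by (simp add: I_def)
  have D_greatest: "k \<le> D i"
    if k: "\<And>s t. 0 \<le> s \<Longrightarrow> s < t \<Longrightarrow> t \<le> 1 \<Longrightarrow> k * (t - s) \<le> ?p t $ i - ?p s $ i" for k i
    unfolding D_def
  proof (rule cINF_greatest)
    show "I \<noteq> {}"
      using I_ne by blast
  qed (auto simp: I_def pos_le_divide_eq k)
  have D_nonneg: "0 \<le> D i" for i
    by (rule D_greatest) (simp add: pmono)
  have D_le: "D i * (t - s) \<le> ?p t $ i - ?p s $ i" if st: "0 \<le> s" "s \<le> t" "t \<le> 1" for s t i
  proof (cases "s = t")
    case False
    have "bdd_below ((\<lambda>(s, t). (?p t $ i - ?p s $ i) / (t - s)) ` I)"
      by (intro bdd_belowI2[where m = 0]) (auto simp: I_def pmono)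
    then have "D i \<le> (case (s, t) of (s, t) \<Rightarrow> (?p t $ i - ?p s $ i) / (t - s))"
      unfolding D_def using False st by (intro cINF_lower) (auto simp: I_def)
    then show ?thesis
      using False st by (simp add: pos_le_divide_eq)
  qed simp
  have "max (z i + (\<Sum>j\<in>UNIV. Q $ j $ i * D j)) 0 \<le> D i" if i: "i \<notin> J" for i
  proof (cases "z i + (\<Sum>j\<in>UNIV. Q $ j $ i * D j) \<le> 0")
    case False
    let ?y = "z i + (\<Sum>j\<in>UNIV. Q $ j $ i * D j)"
    \<comment> \<open>The regulation required at \<open>i\<close>: inflow minus \<open>x\<close>. By
      the definition of \<open>D\<close> its slope is at least \<open>?y\<close>, which is positive
      in this case.\<close>
    define g where "g = (\<lambda>t. (\<Sum>j\<in>UNIV. Q $ j $ i * ?p t $ j) + z i * t)"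
    have g_inc: "?y * (t - s) \<le> g t - g s" if st: "0 \<le> s" "s \<le> t" "t \<le> 1" for s t
    proof -
      have "(\<Sum>j\<in>UNIV. Q $ j $ i * (D j * (t - s))) \<le> (\<Sum>j\<in>UNIV. Q $ j $ i * (?p t $ j - ?p s $ j))"
        by (rule sum_routing_mono[OF Q D_le[OF st]])
      then show ?thesis
        by (simp add: g_def sum_subtractf algebra_simps sum_distrib_left)
    qed
    have g_mono: "g s \<le> g t" if "0 \<le> s" "s \<le> t" "t \<le> 1" for s t
    proof -
      have "0 \<le> ?y * (t - s)"
        using False that by (intro mult_nonneg_nonneg) auto
      then show ?thesis
        using g_inc[OF that] by linarith
    qed
    have g0: "0 \<le> g 0"
      using Q pf by (auto simp: g_def routing_matrix_def intro!: sum_nonneg)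
    have eq: "?p t $ i = g t" if t: "t \<in> {0..1}" for t
    proof (rule antisym)
      show "?p t $ i \<le> g t"
      proof (rule regulator_map_coordinate_le[OF Q R ne _ _ _ _ t])
        show "g \<in> cadlag"
          unfolding g_def by (rule cadlag_regulator_inflow[OF R p])
        show "mono_on {0..1} g"
          by (auto intro!: mono_onI g_mono)
        show "0 \<le> g t" if "t \<in> {0..1}" for t
          using g0 g_mono[of 0 t] that by auto
        show "(\<Sum>j\<in>UNIV. Q $ j $ i * ?p t $ j) - x t $ i \<le> g t" if "t \<in> {0..1}" for t
          using x[OF i that] by (simp add: g_def)
      qed
      show "g t \<le> ?p t $ i"
      proof -
        have "(\<Sum>j\<in>UNIV. Q $ j $ i * ?p t $ j) - x t $ i \<le> ?p t $ i"
          using pf t by blast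
        then show ?thesis
          using x[OF i t] by (simp add: g_def)
      qed
    qed
    have "?y \<le> D i"
      using g_inc eq by (intro D_greatest) auto
    then show ?thesis
      using D_nonneg[of i] by simp
  qed (simp add: D_nonneg)
  \<comment> \<open>On \<open>J\<close> the first alternative holds because \<open>S\<close>
    vanishes there; elsewhere \<open>S\<close> solves the equation and \<open>D\<close> is a
    supersolution.\<close>
  then have "S i \<le> D i \<or> (S i \<le> max (z i + (\<Sum>j\<in>UNIV. Q $ j $ i * S j)) 0 \<and>
      max (z i + (\<Sum>j\<in>UNIV. Q $ j $ i * D j)) 0 \<le> D i)" for i
    using S[of i] SJ[of i] D_nonneg[of i] by (cases "i \<in> J") (simp_all only: order_refl simp_thms not_False_eq_True)
  then have "S i \<le> D i"
    by (rule routing_comparison[OF Q])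
  then have "S i * (t - s) \<le> D i * (t - s)"
    using st by (intro mult_right_mono) auto
  with D_le[OF st, of i] show ?thesis
    by linarith
qed

text \<open>With \<open>v\<close> the claimed bound, inflow plus \<open>(z i + v) * t\<close> is an
  admissible upper bound for coordinate \<open>i\<close> of the regulator: its slope is at least
  \<open>S i\<close>, by the slope bound on the inflow. At time \<open>1\<close> the inflow cancels
  and \<open>v\<close> remains.\<close>

lemma reflection_map_le:
  fixes Q :: "real^'n^'n" and S z :: "'n \<Rightarrow> real"
  assumes Q: "routing_matrix Q"
    and R: "R = transpose (mat 1 - Q)"
    and ne: "feasible_regulators R x \<noteq> {}"
    and x: "\<And>i t. i \<notin> J \<Longrightarrow> t \<in> {0..1} \<Longrightarrow> x t $ i = - z i * t"
    and SJ: "\<And>i. i \<in> J \<Longrightarrow> S i = 0"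
    and S: "\<And>i. i \<notin> J \<Longrightarrow> S i = max (z i + (\<Sum>j\<in>UNIV. Q $ j $ i * S j)) 0"
    and i: "i \<notin> J"
  shows "reflection_map R x 1 $ i \<le> S i - z i - (\<Sum>j\<in>UNIV. Q $ j $ i * S j)"
proof -
  let ?p = "regulator_map R x"
  have p: "?p \<in> feasible_regulators R x"
    by (rule regulator_map_feasible[OF Q R ne])
  note pf = p[unfolded R feasible_regulators_iff, folded R]
  define v where "v = S i - z i - (\<Sum>j\<in>UNIV. Q $ j $ i * S j)"
  \<comment> \<open>The second quantity is just \<open>S i\<close>.\<close>
  have v: "0 \<le> v" "0 \<le> z i + v + (\<Sum>j\<in>UNIV. Q $ j $ i * S j)"
    using S[OF i] by (auto simp: v_def)
  define h where "h = (\<lambda>t. (\<Sum>j\<in>UNIV. Q $ j $ i * ?p t $ j) + (z i + v) * t)"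
  have h_mono: "h s \<le> h t" if st: "0 \<le> s" "s \<le> t" "t \<le> 1" for s t
  proof -
    have "(\<Sum>j\<in>UNIV. Q $ j $ i * (S j * (t - s))) \<le> (\<Sum>j\<in>UNIV. Q $ j $ i * (?p t $ j - ?p s $ j))"
      by (rule sum_routing_mono[OF Q regulator_map_slope[OF Q R ne x SJ S st]])
    moreover have "0 \<le> (z i + v + (\<Sum>j\<in>UNIV. Q $ j $ i * S j)) * (t - s)"
      using v st by (intro mult_nonneg_nonneg) auto
    ultimately show ?thesis
      by (simp add: h_def sum_subtractf algebra_simps sum_distrib_left)
  qed
  have h0: "0 \<le> h 0"
    using Q pf by (auto simp: h_def routing_matrix_def intro!: sum_nonneg)
  have "?p 1 $ i \<le> h 1"
  proof (rule regulator_map_coordinate_le[OF Q R ne])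
    show "h \<in> cadlag"
      unfolding h_def by (rule cadlag_regulator_inflow[OF R p])
    show "mono_on {0..1} h"
      by (auto intro!: mono_onI h_mono)
    show "0 \<le> h t" if "t \<in> {0..1}" for t
      using h0 h_mono[of 0 t] that by auto
    show "(\<Sum>j\<in>UNIV. Q $ j $ i * ?p t $ j) - x t $ i \<le> h t" if "t \<in> {0..1}" for t
      using x[OF i that] v that by (simp add: h_def algebra_simps)
  qed simp
  then show ?thesis
    using x[OF i, of 1] by (simp add: reflection_map_nth[OF R] h_def v_def)
qed

section \<open>Explicit regulators and the lower bound on the reflected path\<close>

text \<open>Regulation at the constant rate \<open>q\<close> cancels the drift
  \<open>- (R *v q) $ i * t\<close> exactly, so any path above this drift stays
  non-negative.\<close>

lemma linear_regulator_feasible: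
  fixes Q :: "real^'n^'n" and q :: "real^'n"
  assumes R: "R = transpose (mat 1 - Q)"
    and q: "\<And>i. 0 \<le> q $ i"
    and x: "\<And>i t. t \<in> {0..1} \<Longrightarrow> - (R *v q) $ i * t \<le> x t $ i"
  shows "(\<lambda>t. t *\<^sub>R q) \<in> feasible_regulators R x"
  unfolding R feasible_regulators_iff
proof (intro conjI allI ballI)
  fix i and t :: real assume t: "t \<in> {0..1}"
  show "(\<Sum>j\<in>UNIV. Q $ j $ i * (t *\<^sub>R q) $ j) - x t $ i \<le> (t *\<^sub>R q) $ i"
    using x[OF t, of i] unfolding R transpose_mat_1_diff_mult
    by (simp add: algebra_simps sum_distrib_left)
qed (auto simp: q intro!: mono_onI cadlag_continuous continuous_intros mult_right_mono)

text \<open>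
  The regulator used here runs at the rate \<open>q\<close> until time \<open>u\<close>, which keeps every station
  balanced, and at the rate \<open>S\<close> afterwards; the jumps of size \<open>M\<close> at time \<open>u\<close> free the
  stations in \<open>J\<close> from any further regulation.
\<close>

lemma reflection_map_ge:
  fixes Q :: "real^'n^'n" and S :: "'n \<Rightarrow> real" and q :: "real^'n"
  assumes Q: "routing_matrix Q"
    and R: "R = transpose (mat 1 - Q)"
    and q: "\<And>i. 0 \<le> q $ i"
    and u: "0 < u" "u \<le> 1"
    and x: "\<And>i t. i \<notin> J \<Longrightarrow> t \<in> {0..1} \<Longrightarrow> x t $ i = - (R *v q) $ i * t"
    and xJ: "\<And>i t. i \<in> J \<Longrightarrow> t \<in> {0..1} \<Longrightarrow>
      x t $ i = (if u \<le> t then M else 0) - (R *v q) $ i * t"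
    and M: "\<And>i. (\<Sum>j\<in>UNIV. Q $ j $ i * (q $ j + S j)) + \<bar>(R *v q) $ i\<bar> \<le> M"
    and SJ: "\<And>i. i \<in> J \<Longrightarrow> S i = 0"
    and S: "\<And>i. i \<notin> J \<Longrightarrow> S i = max ((R *v q) $ i + (\<Sum>j\<in>UNIV. Q $ j $ i * S j)) 0"
    and i: "i \<notin> J"
  shows "S i - (R *v q) $ i - (\<Sum>j\<in>UNIV. Q $ j $ i * S j) - u * (\<Sum>j\<in>UNIV. Q $ j $ i * q $ j)
    \<le> reflection_map R x 1 $ i"
proof -
  let ?p = "regulator_map R x"
  define z where "z = (\<lambda>i. (R *v q) $ i)"
  have S0: "0 \<le> S i" for i
    using S[of i] SJ[of i] by (cases "i \<in> J") auto
  have z: "z i = q $ i - (\<Sum>j\<in>UNIV. Q $ j $ i * q $ j)" for i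
    unfolding z_def R by (rule transpose_mat_1_diff_mult)
  define w :: "real \<Rightarrow> real^'n" where "w = (\<lambda>t. \<chi> j. q $ j * min t u + S j * max (t - u) 0)"
  have sum_w: "(\<Sum>j\<in>UNIV. Q $ j $ i * w t $ j)
      = (\<Sum>j\<in>UNIV. Q $ j $ i * q $ j) * min t u + (\<Sum>j\<in>UNIV. Q $ j $ i * S j) * max (t - u) 0" for i t
    by (simp add: w_def sum.distrib sum_distrib_right distrib_left mult.assoc)
  have w: "w \<in> feasible_regulators R x"
    unfolding R feasible_regulators_iff
  proof (intro conjI allI ballI)
    show "(\<lambda>t. w t $ i) \<in> cadlag" for i
      unfolding w_def vec_lambda_beta by (intro cadlag_continuous continuous_intros)
    show "0 \<le> w t $ i" if "t \<in> {0..1}" for i t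
      using that u q S0 by (simp add: w_def)
    show "mono_on {0..1} (\<lambda>t. w t $ i)" for i
      using q S0 by (auto simp: w_def intro!: mono_onI add_mono mult_left_mono)
    show "(\<Sum>j\<in>UNIV. Q $ j $ i * w t $ j) - x t $ i \<le> w t $ i" if t: "t \<in> {0..1}" for i t
    proof (cases "t < u")
      case True
      then have "x t $ i = - z i * t"
        using x[OF _ t, of i] xJ[OF _ t, of i] by (cases "i \<in> J") (auto simp: z_def)
      then show ?thesis
        using True unfolding sum_w by (simp add: w_def z algebra_simps)
    next
      case False
      show ?thesis
      proof (cases "i \<in> J")
        case True
        have "(\<Sum>j\<in>UNIV. Q $ j $ i * w t $ j) \<le> (\<Sum>j\<in>UNIV. Q $ j $ i * (q $ j + S j))"
        proof (rule sum_routing_mono[OF Q])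
          fix j
          have "q $ j * min t u \<le> q $ j * 1" "S j * max (t - u) 0 \<le> S j * 1"
            by (rule mult_left_mono; use q S0 u t in simp)+
          then show "w t $ j \<le> q $ j + S j"
            by (simp add: w_def)
        qed
        moreover have "z i * t \<le> \<bar>z i\<bar>"
          using t mult_left_le[of t "\<bar>z i\<bar>"] mult_right_mono[OF abs_ge_self[of "z i"], of t] by auto
        moreover have "0 \<le> w t $ i"
          using t u q S0 by (simp add: w_def)
        ultimately show ?thesis
          using M[of i] xJ[OF True t] False by (simp add: z_def)
      next
        case iJ: False
        \<comment> \<open>At time \<open>u\<close> the balance is exact; afterwards the required
          regulation grows at the rate on the left, which the fixed-point equation bounds by
          \<open>S i\<close>.\<close>
        have "(z i + (\<Sum>j\<in>UNIV. Q $ j $ i * S j)) * (t - u) \<le> S i * (t - u)"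
          using S[OF iJ] False by (intro mult_right_mono) (auto simp: z_def)
        then show ?thesis
          using False x[OF iJ t] unfolding sum_w by (simp add: w_def z[unfolded z_def] z algebra_simps)
      qed
    qed
  qed
  then have ne: "feasible_regulators R x \<noteq> {}"
    by blast
  \<comment> \<open>The own regulation is bounded below by the slope bound, the inflow above by the
    explicit \<open>w\<close>, whose initial phase costs the term with the factor
    \<open>u\<close>.\<close>
  have "0 \<le> ?p 0 $ i"
    using regulator_map_feasible[OF Q R ne] unfolding R feasible_regulators_iff by auto
  moreover have "S i * (1 - 0) \<le> ?p 1 $ i - ?p 0 $ i"
    by (rule regulator_map_slope[OF Q R ne x SJ S]) auto
  ultimately have "S i \<le> ?p 1 $ i"
    by simp
  moreover have "(\<Sum>j\<in>UNIV. Q $ j $ i * ?p 1 $ j) \<le> (\<Sum>j\<in>UNIV. Q $ j $ i * (u * q $ j + S j))"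
  proof (rule sum_routing_mono[OF Q])
    fix j
    have "S j * (1 - u) \<le> S j * 1"
      using S0[of j] u by (intro mult_left_mono) auto
    then have "w 1 $ j \<le> u * q $ j + S j"
      using u by (simp add: w_def mult.commute)
    moreover have "?p 1 $ j \<le> w 1 $ j"
      by (rule regulator_map_le[OF w]) simp
    ultimately show "?p 1 $ j \<le> u * q $ j + S j"
      by linarith
  qed
  moreover have "(\<Sum>j\<in>UNIV. Q $ j $ i * (u * q $ j + S j))
      = u * (\<Sum>j\<in>UNIV. Q $ j $ i * q $ j) + (\<Sum>j\<in>UNIV. Q $ j $ i * S j)"
    by (simp add: sum.distrib sum_distrib_left distrib_left mult.left_commute)
  ultimately show ?thesis
    using x[OF i, of 1] unfolding reflection_map_nth[OF R] by simp
qed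

lemma one_jump_path_indicator:
  fixes u M :: real
  assumes u: "0 < u" "u \<le> 1" and M: "0 < M"
  shows "(\<lambda>t. if u \<le> t then M else 0) \<in> one_jump_paths"
proof -
  let ?f = "\<lambda>t::real. if u \<le> t then M else 0"
  have mono: "mono_on {0..1} ?f"
    using M by (auto intro!: mono_onI)
  have "?f \<in> cadlag"
  proof (rule cadlag_mono_on[OF mono])
    fix t e :: real assume t: "0 \<le> t" "t < 1" "0 < e"
    show "\<exists>s\<in>{t<..1}. ?f s < ?f t + e"
    proof (cases "u \<le> t")
      case True
      with t show ?thesis
        by (intro bexI[of _ 1]) auto
    next
      case False
      with t u show ?thesis
        by (intro bexI[of _ "(t + u) / 2"]) auto
    qed
  qed
  moreover have "step_path ?f"
    unfolding step_path_def by (intro exI[of _ "{u}"]) auto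
  moreover have "jump_times ?f = {u}"
  proof -
    have "isCont ?f t" if "t \<noteq> u" for t
    proof (cases "u < t")
      case True
      have "\<forall>\<^sub>F s in nhds t. s \<in> {u<..}"
        using True by (intro eventually_nhds_in_open) auto
      then have "\<forall>\<^sub>F s in nhds t. ?f s = M"
        by eventually_elim auto
      then show ?thesis
        by (subst isCont_cong) auto
    next
      case False
      have "\<forall>\<^sub>F s in nhds t. s \<in> {..<u}"
        using False that by (intro eventually_nhds_in_open) auto
      then have "\<forall>\<^sub>F s in nhds t. ?f s = 0"
        by eventually_elim auto
      then show ?thesis
        by (subst isCont_cong) auto
    qed
    then have "continuous (at t within {0..1}) ?f" if "t \<noteq> u" for t
      using that continuous_at_imp_continuous_at_within by blast
    moreover have "\<not> continuous (at u within {0..1}) ?f"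
    proof
      assume "continuous (at u within {0..1}) ?f"
      then have "\<forall>e>0. \<exists>d>0. \<forall>s\<in>{0..1}. dist s u < d \<longrightarrow> dist (?f s) (?f u) < e"
        unfolding continuous_within_eps_delta by blast
      then obtain d where d: "0 < d" "\<And>s. s \<in> {0..1} \<Longrightarrow> dist s u < d \<Longrightarrow> dist (?f s) (?f u) < M"
        using M by blast
      \<comment> \<open>A time in the unit interval just before the jump, where the path is still
        \<open>0\<close>.\<close>
      define s where "s = max 0 (u - d / 2)"
      have "s \<in> {0..1}" "dist s u < d" "s < u"
        using u d(1) by (auto simp: s_def dist_real_def)
      with d(2)[of s] M show False
        by (simp add: dist_real_def)
    qed
    ultimately show ?thesis
      using u by (auto simp: jump_times_def)
  qed
  ultimately show ?thesis
    using mono u by (simp add: one_jump_paths_def)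
qed

section \<open>The boundary rate and its monotonicity\<close>

text \<open>The diagonal of \<open>Q\<close> vanishes, and the restriction to the complement of
  \<open>J\<close> becomes an extension by zero on \<open>J\<close>. Families with different
  \<open>J\<close> thus become full vectors that can be compared.\<close>

lemma routing_sum_offdiagonal:
  fixes Q :: "real^'n^'n"
  assumes "routing_matrix Q"
  shows "(\<Sum>j | j \<noteq> i \<and> j \<notin> J. Q $ j $ i * f j) = (\<Sum>j\<in>UNIV. Q $ j $ i * (if j \<in> J then 0 else f j))"
  using assms by (intro sum.mono_neutral_cong_left) (auto simp: routing_matrix_def)

lemma is_rstar_iff:
  fixes Q :: "real^'n^'n"
  assumes Q: "routing_matrix Q" and R: "R = transpose (mat 1 - Q)"
  shows "is_rstar Q r' J s \<longleftrightarrow> (\<forall>i. i \<notin> J \<longrightarrow>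
    s $ i = max ((R *v r') $ i + (\<Sum>j\<in>UNIV. Q $ j $ i * (if j \<in> J then 0 else s $ j))) 0)"
  unfolding is_rstar_def R transpose_mat_1_diff_mult routing_sum_offdiagonal[OF Q]
    routing_sum_offdiagonal[OF Q, where J = "{}", simplified] ..

lemma boundary_rate_eq:
  fixes Q :: "real^'n^'n"
  assumes Q: "routing_matrix Q" and R: "R = transpose (mat 1 - Q)"
  shows "boundary_rate Q r' Jc J s
    = (\<Sum>i\<in>Jc. s $ i - (R *v r') $ i - (\<Sum>j\<in>UNIV. Q $ j $ i * (if j \<in> J then 0 else s $ j)))"
  unfolding boundary_rate_def R transpose_mat_1_diff_mult routing_sum_offdiagonal[OF Q]
    routing_sum_offdiagonal[OF Q, where J = "{}", simplified]
  by (simp add: algebra_simps)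

text \<open>Each summand is \<open>max X 0 - X\<close>, which is non-increasing in \<open>X\<close>.
  Enlarging \<open>J\<close> lowers the zero-extended solution by comparison, hence lowers
  \<open>X\<close>.\<close>

lemma boundary_rate_mono:
  fixes Q :: "real^'n^'n"
  assumes Q: "routing_matrix Q"
    and J: "J1 \<subseteq> J2" "J2 \<subseteq> - Jc"
    and s: "is_rstar Q r' J1 s1" "is_rstar Q r' J2 s2"
  shows "boundary_rate Q r' Jc J1 s1 \<le> boundary_rate Q r' Jc J2 s2"
proof -
  define R where "R = transpose (mat 1 - Q)"
  define S where "S = (\<lambda>J (s::real^'n) j. if j \<in> J then 0 else s $ j)"
  define X where "X = (\<lambda>J s i. (R *v r') $ i + (\<Sum>j\<in>UNIV. Q $ j $ i * S J s j))"
  have eq1: "s1 $ i = max (X J1 s1 i) 0" if "i \<notin> J1" for i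
    using s(1) that by (simp add: is_rstar_iff[OF Q R_def] X_def S_def)
  have eq2: "s2 $ i = max (X J2 s2 i) 0" if "i \<notin> J2" for i
    using s(2) that by (simp add: is_rstar_iff[OF Q R_def] X_def S_def)
  have "S J2 s2 i \<le> S J1 s1 i" for i
  proof (rule routing_comparison[OF Q, where z = "\<lambda>i. (R *v r') $ i"])
    fix i
    show "S J2 s2 i \<le> S J1 s1 i \<or>
      S J2 s2 i \<le> max ((R *v r') $ i + (\<Sum>j\<in>UNIV. Q $ j $ i * S J2 s2 j)) 0 \<and>
      max ((R *v r') $ i + (\<Sum>j\<in>UNIV. Q $ j $ i * S J1 s1 j)) 0 \<le> S J1 s1 i"
    proof (cases "i \<in> J2")
      case True
      then have "S J2 s2 i \<le> S J1 s1 i"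
        using eq1[of i] by (auto simp: S_def)
      then show ?thesis ..
    next
      case False
      then have "S J2 s2 i = max (X J2 s2 i) 0" "S J1 s1 i = max (X J1 s1 i) 0"
        using eq1[of i] eq2[of i] J by (auto simp: S_def)
      then show ?thesis
        unfolding X_def by simp
    qed
  qed
  then have X: "X J2 s2 i \<le> X J1 s1 i" for i
    unfolding X_def by (intro add_left_mono sum_routing_mono[OF Q])
  have "s1 $ i - X J1 s1 i \<le> s2 $ i - X J2 s2 i" if "i \<in> Jc" for i
  proof -
    have "i \<notin> J1" "i \<notin> J2"
      using that J by auto
    then show ?thesis
      using X[of i] eq1[of i] eq2[of i] by linarith
  qed
  then have "(\<Sum>i\<in>Jc. s1 $ i - X J1 s1 i) \<le> (\<Sum>i\<in>Jc. s2 $ i - X J2 s2 i)"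
    by (rule sum_mono)
  then show ?thesis
    by (simp add: boundary_rate_eq[OF Q R_def] X_def S_def algebra_simps)
qed

section \<open>Jump paths reaching level \<open>a\<close> and the boundary rate\<close>

theorem proposition6p1:
  fixes Q R :: "real^'n^'n" and r \<rho> r' c :: "real^'n" and a :: real and Jc :: "'n set"
  assumes Q: "routing_matrix Q"
    and R: "R = transpose (mat 1 - Q)"
    and stability: "\<forall>i. (matrix_inv R *v \<rho>) $ i < r $ i"
    and r': "r' = r - matrix_inv R *v \<rho>"
    and a: "a > 0"
    and c: "\<forall>i. c $ i \<in> {0, 1}"
    and Jc: "Jc = {j. c $ j = 1}"
  shows "(\<forall>J rs. J \<subseteq> - Jc \<longrightarrow> is_rstar Q r' J rs \<longrightarrow> boundary_rate Q r' Jc J rs \<noteq> a \<longrightarrow>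
            ((\<exists>\<xi>\<in>cadlag_vec.
                (\<exists>\<theta>. (\<forall>i\<in>J. \<theta> i \<in> one_jump_paths) \<and>
                     (\<forall>t\<in>{0..1}.
                        (\<forall>i. i \<notin> J \<longrightarrow> \<xi> t $ i = - (R *v r') $ i * t) \<and>
                        (\<forall>i\<in>J. \<xi> t $ i = \<theta> i t - (R *v r') $ i * t))) \<and>
                c \<bullet> reflection_map R \<xi> 1 \<ge> a)
             \<longleftrightarrow> boundary_rate Q r' Jc J rs > a)) \<and>
         (\<forall>J1 J2 rs1 rs2. J1 \<subseteq> J2 \<longrightarrow> J2 \<subseteq> - Jc \<longrightarrow>
            is_rstar Q r' J1 rs1 \<longrightarrow> is_rstar Q r' J2 rs2 \<longrightarrow>
            boundary_rate Q r' Jc J1 rs1 \<le> boundary_rate Q r' Jc J2 rs2)"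
proof (intro conjI allI impI)
  fix J1 J2 rs1 rs2
  assume "J1 \<subseteq> J2" "J2 \<subseteq> - Jc" "is_rstar Q r' J1 rs1" "is_rstar Q r' J2 rs2"
  then show "boundary_rate Q r' Jc J1 rs1 \<le> boundary_rate Q r' Jc J2 rs2"
    by (rule boundary_rate_mono[OF Q])
next
  fix J rs
  assume J: "J \<subseteq> - Jc" and rs: "is_rstar Q r' J rs" and neq: "boundary_rate Q r' Jc J rs \<noteq> a"
  have r'_nonneg: "0 \<le> r' $ i" for i
    using stability by (simp add: r' less_imp_le)
  have c_inner: "c \<bullet> y = (\<Sum>i\<in>Jc. y $ i)" for y
  proof -
    have "c \<bullet> y = (\<Sum>i\<in>UNIV. if i \<in> Jc then y $ i else 0)"
      using c by (auto simp: inner_vec_def Jc intro!: sum.cong)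
    then show ?thesis
      by (simp add: sum.If_cases)
  qed
  \<comment> \<open>The entries of \<open>rs\<close> on \<open>J\<close> are arbitrary; resetting
    them to \<open>0\<close> gives the form required by the bounds above.\<close>
  define S where "S = (\<lambda>j. if j \<in> J then 0 else rs $ j)"
  have SJ: "S i = 0" if "i \<in> J" for i
    using that by (simp add: S_def)
  have S: "S i = max ((R *v r') $ i + (\<Sum>j\<in>UNIV. Q $ j $ i * S j)) 0" if "i \<notin> J" for i
    using rs that unfolding is_rstar_iff[OF Q R] S_def by simp
  have rate: "boundary_rate Q r' Jc J rs
      = (\<Sum>i\<in>Jc. S i - (R *v r') $ i - (\<Sum>j\<in>UNIV. Q $ j $ i * S j))"
    unfolding boundary_rate_eq[OF Q R] using J by (auto simp: S_def intro!: sum.cong)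
  show "(\<exists>\<xi>\<in>cadlag_vec.
      (\<exists>\<theta>. (\<forall>i\<in>J. \<theta> i \<in> one_jump_paths) \<and>
         (\<forall>t\<in>{0..1}.
            (\<forall>i. i \<notin> J \<longrightarrow> \<xi> t $ i = - (R *v r') $ i * t) \<and>
            (\<forall>i\<in>J. \<xi> t $ i = \<theta> i t - (R *v r') $ i * t))) \<and>
      c \<bullet> reflection_map R \<xi> 1 \<ge> a)
    \<longleftrightarrow> boundary_rate Q r' Jc J rs > a" (is "?L \<longleftrightarrow> ?R")
  proof
    assume ?L
    then obtain \<xi> \<theta> where \<theta>: "\<And>i. i \<in> J \<Longrightarrow> \<theta> i \<in> one_jump_paths"
      and \<xi>: "\<And>i t. i \<notin> J \<Longrightarrow> t \<in> {0..1} \<Longrightarrow> \<xi> t $ i = - (R *v r') $ i * t"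
      and \<xi>J: "\<And>i t. i \<in> J \<Longrightarrow> t \<in> {0..1} \<Longrightarrow> \<xi> t $ i = \<theta> i t - (R *v r') $ i * t"
      and ge: "a \<le> c \<bullet> reflection_map R \<xi> 1"
      by blast
    \<comment> \<open>Jumps only push the path up, so the regulator for the pure drift remains
      feasible; this supplies the non-emptiness needed for the upper bound.\<close>
    have "(\<lambda>t. t *\<^sub>R r') \<in> feasible_regulators R \<xi>"
    proof (rule linear_regulator_feasible[OF R r'_nonneg])
      fix i and t :: real assume t: "t \<in> {0..1}"
      show "- (R *v r') $ i * t \<le> \<xi> t $ i"
      proof (cases "i \<in> J")
        case True
        then have "mono_on {0..1} (\<theta> i)" "\<theta> i 0 = 0"
          using \<theta> by (auto simp: one_jump_paths_def)
        then have "0 \<le> \<theta> i t"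
          using mono_onD[of "{0..1}" "\<theta> i" 0 t] t by auto
        with True t show ?thesis
          by (simp add: \<xi>J)
      next
        case False
        then show ?thesis
          using \<xi>[OF _ t] by simp
      qed
    qed
    then have ne: "feasible_regulators R \<xi> \<noteq> {}"
      by blast
    have "c \<bullet> reflection_map R \<xi> 1 \<le> boundary_rate Q r' Jc J rs"
      unfolding c_inner rate using J by (intro sum_mono reflection_map_le[OF Q R ne \<xi> SJ S]) auto
    with ge neq show ?R
      by linarith
  next
    assume rate_gt: ?R
    define C where "C = (\<Sum>i\<in>Jc. \<Sum>j\<in>UNIV. Q $ j $ i * r' $ j)"
    have Q0: "0 \<le> Q $ i $ j" for i j
      using Q by (simp add: routing_matrix_def)
    have C: "0 \<le> C"
      unfolding C_def by (intro sum_nonneg mult_nonneg_nonneg Q0 r'_nonneg)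
    \<comment> \<open>The loss in the lower bound, summed over \<open>Jc\<close>, is
      \<open>u * C\<close>, and this choice keeps it below the gap to \<open>a\<close>. Using
      \<open>C + 1\<close> avoids division by zero.\<close>
    define u where "u = min 1 ((boundary_rate Q r' Jc J rs - a) / (C + 1))"
    have u: "0 < u" "u \<le> 1"
      using rate_gt C by (auto simp: u_def)
    have "u * (C + 1) \<le> boundary_rate Q r' Jc J rs - a"
      using C by (subst pos_le_divide_eq[symmetric]) (auto simp: u_def)
    then have uC: "u * C \<le> boundary_rate Q r' Jc J rs - a"
      using u by (simp add: algebra_simps)
    define b where "b = (\<lambda>i. (\<Sum>j\<in>UNIV. Q $ j $ i * (r' $ j + S j)) + \<bar>(R *v r') $ i\<bar>)"
    have S0: "0 \<le> S i" for i
      using S[of i] SJ[of i] by (cases "i \<in> J") auto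
    have b: "0 \<le> b i" for i
      unfolding b_def by (intro add_nonneg_nonneg sum_nonneg mult_nonneg_nonneg Q0 r'_nonneg S0 abs_ge_zero)
    \<comment> \<open>One jump size serves all stations in \<open>J\<close>; adding \<open>1\<close>
      keeps it positive even when every \<open>b i\<close> is \<open>0\<close>.\<close>
    define M where "M = (\<Sum>i\<in>UNIV. b i) + 1"
    have M: "b i \<le> M" "0 < M" for i
      using member_le_sum[of i UNIV b] b sum_nonneg[of UNIV b] by (auto simp: M_def)
    define \<theta> where "\<theta> = (\<lambda>t. if u \<le> t then M else 0)"
    define \<xi> :: "real \<Rightarrow> real^'n"
      where "\<xi> = (\<lambda>t. \<chi> i. (if i \<in> J then \<theta> t else 0) - (R *v r') $ i * t)"
    have \<theta>: "\<theta> \<in> one_jump_paths"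
      unfolding \<theta>_def by (rule one_jump_path_indicator[OF u M(2)])
    have "(\<lambda>t. \<xi> t $ i) \<in> cadlag" for i
    proof -
      have "(\<lambda>t. (if i \<in> J then \<theta> t else 0) + (- (R *v r') $ i) * t) \<in> cadlag"
      proof (rule cadlag_add)
        show "(\<lambda>t. if i \<in> J then \<theta> t else 0) \<in> cadlag"
          using \<theta> by (cases "i \<in> J") (auto simp: one_jump_paths_def intro: cadlag_continuous)
      qed (intro cadlag_continuous continuous_intros)
      then show ?thesis
        by (simp add: \<xi>_def)
    qed
    then have \<xi>: "\<xi> \<in> cadlag_vec"
      by (simp add: cadlag_vec_def)
    have "boundary_rate Q r' Jc J rs - u * C
        = (\<Sum>i\<in>Jc. S i - (R *v r') $ i - (\<Sum>j\<in>UNIV. Q $ j $ i * S j)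
            - u * (\<Sum>j\<in>UNIV. Q $ j $ i * r' $ j))"
      unfolding rate C_def sum_distrib_left[of u] by (simp add: sum_subtractf)
    also have "\<dots> \<le> (\<Sum>i\<in>Jc. reflection_map R \<xi> 1 $ i)"
    proof (rule sum_mono)
      fix i assume "i \<in> Jc"
      with J have i: "i \<notin> J"
        by auto
      show "S i - (R *v r') $ i - (\<Sum>j\<in>UNIV. Q $ j $ i * S j) - u * (\<Sum>j\<in>UNIV. Q $ j $ i * r' $ j)
          \<le> reflection_map R \<xi> 1 $ i"
        by (rule reflection_map_ge[OF Q R r'_nonneg u _ _ M(1)[unfolded b_def] SJ S i])
          (auto simp: \<xi>_def \<theta>_def)
    qed
    finally have "a \<le> c \<bullet> reflection_map R \<xi> 1"
      using uC by (simp add: c_inner)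
    with \<xi> \<theta> show ?L
      by (intro bexI[of _ \<xi>] conjI exI[of _ "\<lambda>_. \<theta>"]) (auto simp: \<xi>_def)
  qed
qed

end
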